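(* Let $P\subset\mathbb{R}^d$ be a $d$-dimensional convex polytope with $P=-P^\circ$, and let $G_P$ be the graph on the vertex set of $P$ in which vertices $v,w$ are adjacent iff $\langle v,w\rangle=-1$. Then the chromatic number satisfies $\chi(G_P)\ge d+1$, and $G_P$ contains a $(d+1)$-clique if and only if $P$ is a simplex.
   Context: For $A\subseteq\mathbb{R}^d$, the polar is $A^\circ=\{x\in\mathbb{R}^d:\langle x,a\rangle\le 1\text{ for all }a\in A\}$ and $-A=\{-a:a\in A\}$. A $(d+1)$-clique is a set of $d+1$ pairwise adjacent vertices. *)

theory Defs
  imports "HOL-Analysis.Analysis" "Graph_Theory.Pair_Digraph"
begin

definition polar :: "'a::real_inner set \<Rightarrow> 'a set" where
  "polar A = {x. \<forall>a\<in>A. x \<bullet> a \<le> 1}"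

text \<open>As in \<^theory>\<open>Graph_Theory.Pair_Digraph\<close>, an undirected graph is a symmetric set of
  ordered pairs. Loops cannot occur below, since \<^term>\<open>v \<bullet> v \<ge> 0\<close>.\<close>

definition polytope_graph :: "'a::real_inner set \<Rightarrow> 'a pair_pre_digraph" where
  "polytope_graph P =
    \<lparr> pverts = {v. v extreme_point_of P},
      parcs = {(v, w). v extreme_point_of P \<and> w extreme_point_of P \<and> v \<bullet> w = -1} \<rparr>"

lemma pair_graph_polytope_graph:
  fixes P :: "'a::euclidean_space set"
  assumes "polytope P"
  shows "pair_graph (polytope_graph P)"
proof -
  have fin: "finite {v. v extreme_point_of P}"
    using assms by (simp add: finite_polyhedron_extreme_points polytope_imp_polyhedron)
  show ?thesis
  proof
    show "finite (parcs (polytope_graph P))"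
      by (rule finite_subset[OF _ finite_cartesian_product[OF fin fin]])
        (auto simp: polytope_graph_def)
    show "symmetric (with_proj (polytope_graph P))"
      by (auto simp: polytope_graph_def symmetric_def sym_def inner_commute)
    show "fst e \<noteq> snd e" if "e \<in> parcs (polytope_graph P)" for e
    proof
      assume "fst e = snd e"
      then have "fst e \<bullet> fst e = -1"
        using that by (auto simp: polytope_graph_def)
      then show False
        using inner_ge_zero[of "fst e"] by linarith
    qed
  qed (use fin in \<open>auto simp: polytope_graph_def\<close>)
qed

definition proper_colouring :: "'a pair_pre_digraph \<Rightarrow> ('a \<Rightarrow> 'c) \<Rightarrow> bool" where
  "proper_colouring G c \<longleftrightarrow> (\<forall>(v, w) \<in> parcs G. c v \<noteq> c w)"

definition colourable :: "'a pair_pre_digraph \<Rightarrow> nat \<Rightarrow> bool" where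
  "colourable G k \<longleftrightarrow> (\<exists>c :: 'a \<Rightarrow> nat. c ` pverts G \<subseteq> {..<k} \<and> proper_colouring G c)"

text \<open>Only meaningful when \<^term>\<open>G\<close> is colourable with finitely many colours;
  the lemma after the definition covers finite loop-free graphs.\<close>

definition chromatic_number :: "'a pair_pre_digraph \<Rightarrow> nat" where
  "chromatic_number G = (LEAST k. colourable G k)"

lemma colourable_chromatic_number:
  assumes "pair_graph G"
  shows "colourable G (chromatic_number G)"
proof -
  interpret pair_graph G by fact
  obtain c :: "'a \<Rightarrow> nat" where "bij_betw c (pverts G) {0..<card (pverts G)}"
    using ex_bij_betw_finite_nat[OF pair_finite_verts] by blast
  then have c: "c ` pverts G = {..<card (pverts G)}" "inj_on c (pverts G)"
    by (auto simp: bij_betw_def atLeast0LessThan)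
  have "c v \<noteq> c w" if "(v, w) \<in> parcs G" for v w
    using that c(2) in_arcsD1[OF that] in_arcsD2[OF that] pair_no_loops[OF that]
    by (simp add: inj_on_eq_iff)
  then have "proper_colouring G c"
    unfolding proper_colouring_def by blast
  then have "colourable G (card (pverts G))"
    using c(1) unfolding colourable_def by blast
  then show ?thesis
    unfolding chromatic_number_def by (rule LeastI)
qed

definition clique :: "'a pair_pre_digraph \<Rightarrow> nat \<Rightarrow> 'a set \<Rightarrow> bool" where
  "clique G k K \<longleftrightarrow> K \<subseteq> pverts G \<and> finite K \<and> card K = k \<and>
    (\<forall>v\<in>K. \<forall>w\<in>K. v \<noteq> w \<longrightarrow> (v, w) \<in> parcs G)"

end

(*
  A point of the sphere S^(d-1) lies in a unique way in a ray spanned by y - y' with y, y' in P and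
  <y, y'> = -1, by Moreau's decomposition for the self-dual cone over P; negation exchanges y and y'.
  Every vertex of the smallest face containing y is adjacent to every vertex of the smallest face
  containing y'. In a proper colouring with d colours, the points x for which colour i occurs in the
  smallest face containing y would therefore form d open sets that cover the sphere, none of which
  contains an antipodal pair, against the Lusternik-Schnirelmann theorem.

  That theorem is proved as in Ky Fan's lemma, but with singular chains in place of a symmetric
  triangulation. Since the sphere has trivial reduced homology below the top dimension, there are
  chains c_0 (a point), ..., c_n in it such that the boundary of c_(k+1) is c_k plus or minus its
  antipodal image. After a fine subdivision, an antipodal labelling by n signed labels without
  complementary labels in a simplex would make the number of alternating simplices in c_k odd for
  every k; but for k = n there are too few labels for a simplex to alternate.
*)
theory Submission
  imports Defs "HOL-Homology.Homology"
begin

subsection \<open>Alternating lists of signs\<close>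

definition delete_nth :: "nat \<Rightarrow> 'a list \<Rightarrow> 'a list" where
  "delete_nth k xs = take k xs @ drop (Suc k) xs"

lemma delete_nth_0 [simp]: "delete_nth 0 (x # xs) = xs"
  and delete_nth_Suc [simp]: "delete_nth (Suc k) (x # xs) = x # delete_nth k xs"
  by (auto simp: delete_nth_def)

lemma map_delete_nth: "map f (delete_nth k xs) = delete_nth k (map f xs)"
  by (simp add: delete_nth_def take_map drop_map)

lemma mset_delete_nth:
  assumes "k < length xs"
  shows "mset (delete_nth k xs) = mset xs - {#xs ! k#}"
proof -
  have "mset xs = mset (take k xs @ xs ! k # drop (Suc k) xs)"
    using assms by (simp add: id_take_nth_drop [symmetric])
  then show ?thesis
    by (simp add: delete_nth_def)
qed

lemma sorted_delete_nth:
  assumes "sorted xs"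
  shows "sorted (delete_nth k xs)"
proof (cases "k < length xs")
  case True
  then show ?thesis
    using assms id_take_nth_drop [OF True]
    by (metis delete_nth_def sorted_append sorted_wrt.simps(2) Un_iff insert_iff list.simps(15) set_append)
next
  case False
  then show ?thesis
    using assms by (simp add: delete_nth_def)
qed

text \<open>Both sides run over the removals of one entry from the same multiset and evaluate
  \<open>g\<close> at the sorted remainder. Hence the faces of a simplex may be indexed by the
  positions in its sorted list of labels.\<close>

lemma sum_sort_delete_nth:
  fixes g :: "'a::linorder list \<Rightarrow> 'b::comm_monoid_add"
  shows "(\<Sum>k<length xs. g (sort (delete_nth k xs))) = (\<Sum>k<length xs. g (delete_nth k (sort xs)))"
proof -
  define h where "h y = g (sorted_list_of_multiset (mset xs - {#y#}))" for y
  have "(\<Sum>k<length xs. g (sort (delete_nth k xs))) = (\<Sum>k<length xs. h (xs ! k))"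
    by (rule sum.cong) (auto simp: h_def mset_delete_nth simp flip: sorted_list_of_multiset_mset)
  also have "\<dots> = sum_mset (image_mset h (mset xs))"
    by (simp add: sum_mset_sum_list sum_list_sum_nth atLeast0LessThan flip: mset_map)
  also have "\<dots> = sum_mset (image_mset h (mset (sort xs)))"
    by simp
  also have "\<dots> = (\<Sum>k<length (sort xs). h (sort xs ! k))"
    unfolding mset_map [symmetric] sum_mset_sum_list
    by (simp add: sum_list_sum_nth atLeast0LessThan)
  also have "\<dots> = (\<Sum>k<length xs. g (delete_nth k (sort xs)))"
  proof (rule sum.cong)
    fix k assume k: "k \<in> {..<length xs}"
    have "delete_nth k (sort xs) = sorted_list_of_multiset (mset (delete_nth k (sort xs)))"
      by (simp add: sorted_delete_nth sorted_sort_id)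
    also have "\<dots> = sorted_list_of_multiset (mset xs - {#sort xs ! k#})"
      using k by (subst mset_delete_nth) auto
    finally show "h (sort xs ! k) = g (delete_nth k (sort xs))"
      by (simp add: h_def)
  qed auto
  finally show ?thesis .
qed

fun alternating :: "bool \<Rightarrow> bool list \<Rightarrow> bool" where
  "alternating b [] = True"
| "alternating b (x # xs) = (x = b \<and> alternating (\<not> b) xs)"

lemma alternating_Not: "alternating b (map Not xs) = alternating (\<not> b) xs"
  by (induction xs arbitrary: b) auto

text \<open>The combinatorial core of Ky Fan's argument. A nonempty list alternating from
  \<open>b\<close> has one good deletion, its last entry; one alternating from
  \<open>\<not> b\<close> has one, its first entry. Any other list has none or two, the members of
  its only pair of equal neighbours.\<close>

lemma even_sum_alternating_delete_nth:
  "even ((\<Sum>k<length xs. of_bool (alternating b (delete_nth k xs)))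
     + of_bool (alternating b xs) + of_bool (alternating (\<not> b) xs) :: int)"
proof (induction xs arbitrary: b)
  case (Cons x xs)
  show ?case
    using Cons.IH [of "\<not> b"]
    by (cases "x = b") (auto simp: sum.lessThan_Suc_shift simp del: sum.lessThan_Suc)
qed auto

text \<open>The signed labels \<open>+i\<close> and \<open>-i\<close> are encoded as the numbers \<open>2 i\<close> and \<open>2 i + 1\<close>.\<close>
definition flip :: "nat \<Rightarrow> nat" where
  "flip m = (if even m then Suc m else m - 1)"

lemma even_flip [simp]: "even (flip m) \<longleftrightarrow> odd m"
  by (auto simp: flip_def)

lemma flip_mono_if:
  assumes "m \<le> m'" "m' \<noteq> flip m"
  shows "flip m \<le> flip m'"
  using assms by (auto simp: flip_def elim!: evenE oddE)

text \<open>\<open>flip\<close> only swaps the members of each pair \<open>2 i\<close>,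
  \<open>2 i + 1\<close>. A list without complementary labels never contains both, so
  \<open>flip\<close> preserves its order.\<close>

lemma sort_map_flip:
  assumes "\<And>m. m \<in> set xs \<Longrightarrow> flip m \<notin> set xs"
  shows "sort (map flip xs) = map flip (sort xs)"
proof (rule properties_for_sort)
  show "sorted (map flip (sort xs))"
    unfolding sorted_map
    by (rule sorted_wrt_mono_rel [OF _ sorted_sort]) (metis assms flip_mono_if set_sort)
qed simp

text \<open>Neighbours of opposite parity with the same index would be complementary, so every
  change of sign also raises the index.\<close>

lemma sorted_alternating_div2:
  assumes "sorted xs" "alternating b (map even xs)" "\<And>m. m \<in> set xs \<Longrightarrow> flip m \<notin> set xs"
  shows "sorted_wrt (<) (map (\<lambda>m. m div 2) xs)"
  using assms
proof (induction xs arbitrary: b)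
  case (Cons x xs)
  have IH: "sorted_wrt (<) (map (\<lambda>m. m div 2) xs)"
    using Cons.prems by (intro Cons.IH [of "\<not> b"]) auto
  have "x div 2 < y div 2" if "y \<in> set xs" for y
  proof (cases xs)
    case (Cons z zs)
    have "x \<le> z" "even x \<noteq> even z" "z \<noteq> flip x"
      using Cons.prems Cons by auto
    then have "x div 2 < z div 2"
      unfolding flip_def by (auto split: if_splits) presburger+
    moreover have "z div 2 \<le> y div 2"
      using IH that Cons by auto
    ultimately show ?thesis
      by simp
  qed (use that in auto)
  then show ?case
    using IH by auto
qed auto

subsection \<open>Alternating simplices\<close>

definition vertex_labels :: "('a \<Rightarrow> nat) \<Rightarrow> nat \<Rightarrow> ((nat \<Rightarrow> real) \<Rightarrow> 'a) \<Rightarrow> nat list" where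
  "vertex_labels lab p f = map (\<lambda>j. lab (f (\<lambda>i. if i = j then 1 else 0))) [0..<Suc p]"

lemma length_vertex_labels [simp]: "length (vertex_labels lab p f) = Suc p"
  by (simp add: vertex_labels_def)

lemma set_vertex_labels_subset: "set (vertex_labels lab p f) \<subseteq> lab ` f ` standard_simplex p"
  by (auto simp: vertex_labels_def)

lemma nth_delete_nth:
  assumes "k < length xs"
  shows "delete_nth k xs ! j = (if j < k then xs ! j else xs ! Suc j)"
  using assms by (auto simp: delete_nth_def nth_append min_def)

lemma vertex_labels_singular_face:
  assumes "k \<le> Suc p"
  shows "vertex_labels lab p (singular_face (Suc p) k f) = delete_nth k (vertex_labels lab (Suc p) f)"
proof (rule nth_equalityI)
  show "length (vertex_labels lab p (singular_face (Suc p) k f)) =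
      length (delete_nth k (vertex_labels lab (Suc p) f))"
    using assms by (simp add: delete_nth_def)
  fix j assume "j < length (vertex_labels lab p (singular_face (Suc p) k f))"
  then have j: "j \<le> p"
    by simp
  \<comment> \<open>The face inclusion sends vertex \<open>j\<close> to vertex \<open>j\<close> or
    \<open>Suc j\<close>, omitting vertex \<open>k\<close>.\<close>
  have *: "simplical_face k (\<lambda>i. if i = j then 1 else 0) =
      (\<lambda>i. if i = (if j < k then j else Suc j) then 1 else (0::real))"
    by (auto simp: simplical_face_def fun_eq_iff)
  have "vertex_labels lab p (singular_face (Suc p) k f) ! j =
      lab (f (simplical_face k (\<lambda>i. if i = j then 1 else 0)))"
    using j by (simp add: vertex_labels_def singular_face_def del: upt_Suc)
  then show "vertex_labels lab p (singular_face (Suc p) k f) ! j =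
      delete_nth k (vertex_labels lab (Suc p) f) ! j"
    unfolding *
    using j assms by (auto simp: nth_delete_nth vertex_labels_def simp del: upt_Suc)
qed

lemma vertex_labels_simplex_map:
  "vertex_labels lab p (simplex_map p g f) = vertex_labels (lab \<circ> g) p f"
  by (auto simp: vertex_labels_def simplex_map_def)

text \<open>Sorting arranges the labels by index, whatever the order of the vertices; the parity of
  a label is its sign, and \<open>b\<close> is the sign of the smallest index.\<close>

definition alternating_simplex :: "('a \<Rightarrow> nat) \<Rightarrow> bool \<Rightarrow> nat \<Rightarrow> ((nat \<Rightarrow> real) \<Rightarrow> 'a) \<Rightarrow> bool" where
  "alternating_simplex lab b p f \<longleftrightarrow> alternating b (map even (sort (vertex_labels lab p f)))"

lemma even_sum_alternating_faces:
  "even ((\<Sum>k\<le>Suc p. of_bool (alternating_simplex lab b p (singular_face (Suc p) k f)))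
     + of_bool (alternating_simplex lab b (Suc p) f)
     + of_bool (alternating_simplex lab (\<not> b) (Suc p) f) :: int)"
proof -
  let ?xs = "vertex_labels lab (Suc p) f"
  have "(\<Sum>k\<le>Suc p. of_bool (alternating_simplex lab b p (singular_face (Suc p) k f))) =
      (\<Sum>k<length ?xs. of_bool (alternating b (map even (sort (delete_nth k ?xs)))) :: int)"
    unfolding length_vertex_labels lessThan_Suc_atMost
    by (rule sum.cong) (simp_all add: alternating_simplex_def vertex_labels_singular_face)
  also have "\<dots> = (\<Sum>k<length ?xs. of_bool (alternating b (map even (delete_nth k (sort ?xs)))))"
    by (rule sum_sort_delete_nth)
  also have "\<dots> = (\<Sum>k<length (map even (sort ?xs)).
      of_bool (alternating b (delete_nth k (map even (sort ?xs)))))"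
    by (simp add: map_delete_nth)
  finally show ?thesis
    using even_sum_alternating_delete_nth [of b "map even (sort ?xs)"]
    by (simp add: alternating_simplex_def)
qed

text \<open>An integer is the coefficient of a free Abelian group on one generator, so that additivity
  comes from \<open>frag_extend\<close>.\<close>
definition alternating_count :: "('a \<Rightarrow> nat) \<Rightarrow> bool \<Rightarrow> nat \<Rightarrow> 'a chain \<Rightarrow> int" where
  "alternating_count lab b p c = Poly_Mapping.lookup
     (frag_extend (\<lambda>f. frag_cmul (of_bool (alternating_simplex lab b p f)) (frag_of ())) c) ()"

lemma alternating_count_0 [simp]: "alternating_count lab b p 0 = 0"
  by (simp add: alternating_count_def)

lemma alternating_count_of [simp]:
  "alternating_count lab b p (frag_of f) = of_bool (alternating_simplex lab b p f)"
  by (simp add: alternating_count_def)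

lemma alternating_count_cmul [simp]:
  "alternating_count lab b p (frag_cmul k c) = k * alternating_count lab b p c"
  by (simp add: alternating_count_def frag_extend_cmul)

lemma alternating_count_add:
  "alternating_count lab b p (c + d) = alternating_count lab b p c + alternating_count lab b p d"
  by (simp add: alternating_count_def frag_extend_add lookup_add)

lemma alternating_count_diff:
  "alternating_count lab b p (c - d) = alternating_count lab b p c - alternating_count lab b p d"
  by (simp add: alternating_count_def frag_extend_diff lookup_minus)

lemma alternating_count_sum:
  "alternating_count lab b p (sum c I) = (\<Sum>i\<in>I. alternating_count lab b p (c i))"
  by (induction I rule: infinite_finite_induct) (simp_all add: alternating_count_add)

text \<open>All terms are additive in \<open>c\<close>, and the signs of the faces disappear modulo
  2, so the count over the faces of a single simplex suffices.\<close>

lemma even_alternating_count_boundary: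
  "even (alternating_count lab b p (chain_boundary (Suc p) c)
     + alternating_count lab b (Suc p) c + alternating_count lab (\<not> b) (Suc p) c)"
  using subset_UNIV
proof (induction c rule: frag_induction)
  case (one f)
  have "alternating_count lab b p (chain_boundary (Suc p) (frag_of f)) =
     (\<Sum>k\<le>Suc p. (-1) ^ k * of_bool (alternating_simplex lab b p (singular_face (Suc p) k f)))"
    unfolding chain_boundary_of by (simp add: alternating_count_sum del: sum.atMost_Suc)
  moreover have "even (\<dots> + (\<Sum>k\<le>Suc p. of_bool (alternating_simplex lab b p (singular_face (Suc p) k f))))"
    unfolding sum.distrib [symmetric] by (rule dvd_sum) auto
  ultimately show ?case
    using even_sum_alternating_faces [of lab b p f]
    unfolding alternating_count_of by presburger
next
  case (diff c d)
  then show ?case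
    unfolding chain_boundary_diff alternating_count_diff by presburger
qed auto

text \<open>If \<open>g\<close> flips every label, then it keeps the sorted order of the labels and
  negates all signs, which interchanges the two starting signs.\<close>

lemma alternating_count_chain_map:
  assumes "\<And>f m. \<lbrakk>f \<in> Poly_Mapping.keys c; m \<in> set (vertex_labels lab p f)\<rbrakk>
      \<Longrightarrow> flip m \<notin> set (vertex_labels lab p f)"
    and "\<And>f. f \<in> Poly_Mapping.keys c \<Longrightarrow> vertex_labels (lab \<circ> g) p f = map flip (vertex_labels lab p f)"
  shows "alternating_count lab b p (chain_map p g c) = alternating_count lab (\<not> b) p c"
  using order_refl
proof (induction c rule: frag_induction)
  case (one f)
  have "map even (map flip xs) = map Not (map even xs)" for xs
    by simp
  with one show ?case
    by (simp add: alternating_simplex_def vertex_labels_simplex_map sort_map_flip alternating_Not assms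
        del: map_map)
qed (auto simp: chain_map_diff alternating_count_diff)

text \<open>Pigeonhole: an alternating simplex of dimension \<open>n\<close> would carry
  \<open>n + 1\<close> distinct indices, all below \<open>n\<close>.\<close>

lemma alternating_count_eq_0:
  assumes "\<And>f m. \<lbrakk>f \<in> Poly_Mapping.keys c; m \<in> set (vertex_labels lab n f)\<rbrakk>
      \<Longrightarrow> m < 2 * n \<and> flip m \<notin> set (vertex_labels lab n f)"
  shows "alternating_count lab b n c = 0"
  using order_refl
proof (induction c rule: frag_induction)
  case (one f)
  let ?xs = "sort (vertex_labels lab n f)"
  have "\<not> alternating b (map even ?xs)"
  proof
    assume "alternating b (map even ?xs)"
    then have "sorted_wrt (<) (map (\<lambda>m. m div 2) ?xs)"
      using assms [OF one] by (intro sorted_alternating_div2) auto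
    then have "card (set (map (\<lambda>m. m div 2) ?xs)) = Suc n"
      by (subst distinct_card) (auto simp: strict_sorted_iff)
    moreover have "set (map (\<lambda>m. m div 2) ?xs) \<subseteq> {..<n}"
      using assms [OF one] by fastforce
    ultimately show False
      using card_mono [of "{..<n}" "set (map (\<lambda>m. m div 2) ?xs)"] by simp
  qed
  then show ?case
    by (simp add: alternating_simplex_def)
qed (auto simp: alternating_count_diff)

subsection \<open>The Lusternik-Schnirelmann theorem\<close>

lemma singular_subdivision_cmul:
  "singular_subdivision p (frag_cmul k c) = frag_cmul k (singular_subdivision p c)"
  by (simp add: singular_subdivision_def frag_extend_cmul)

lemma iterated_subdivision_chain:
  assumes "singular_chain p X c"
  shows "singular_chain p X ((singular_subdivision p ^^ m) c)"
  by (induction m) (auto simp: assms singular_chain_singular_subdivision)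

lemma iterated_subdivision_add:
  "(singular_subdivision p ^^ m) (c + d) = (singular_subdivision p ^^ m) c + (singular_subdivision p ^^ m) d"
  by (induction m) (auto simp: singular_subdivision_add)

lemma iterated_subdivision_cmul:
  "(singular_subdivision p ^^ m) (frag_cmul k c) = frag_cmul k ((singular_subdivision p ^^ m) c)"
  by (induction m) (auto simp: singular_subdivision_cmul)

lemma chain_boundary_iterated_subdivision:
  assumes "singular_chain (Suc p) X c"
  shows "chain_boundary (Suc p) ((singular_subdivision (Suc p) ^^ m) c) =
    (singular_subdivision p ^^ m) (chain_boundary (Suc p) c)"
  by (induction m)
    (auto simp: chain_boundary_singular_subdivision [OF iterated_subdivision_chain [OF assms]])

lemma iterated_subdivision_chain_map:
  assumes "singular_chain p X c"
  shows "(singular_subdivision p ^^ m) (chain_map p g c) = chain_map p g ((singular_subdivision p ^^ m) c)"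
  by (induction m)
    (auto simp: naturality_singular_subdivision [OF iterated_subdivision_chain [OF assms]])

lemma iterated_subdivision_zero:
  assumes "singular_chain 0 X c"
  shows "(singular_subdivision 0 ^^ m) c = c"
  by (induction m) (auto simp: singular_subdivision_zero [OF assms])

section \<open>Antipodal chains and closed covers\<close>

text \<open>In degree 0 the reduced group is the kernel of the map to the homology of a point, so
  \<open>c0\<close> asks that the class of \<open>c\<close> vanish there.\<close>

lemma singular_boundary_if_trivial_reduced_homology:
  assumes triv: "trivial_group (reduced_homology_group (int p) X)"
    and c: "singular_relcycle p X {} c"
    and c0: "p = 0 \<Longrightarrow> singular_relboundary 0 (discrete_topology {()}) {} (chain_map 0 (\<lambda>x. ()) c)"
  shows "singular_relboundary p X {} c"
proof -
  let ?h = "hom_induced (int p) X {} (discrete_topology {()}) {} (\<lambda>x. ())"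
  have car: "homologous_rel_set p X {} c \<in> carrier (homology_group (int p) X)"
    using c by (auto simp: carrier_relative_homology_group)
  have "homologous_rel_set p X {} c \<in> carrier (reduced_homology_group (int p) X)"
  proof (cases "p = 0")
    case True
    have "?h (homologous_rel_set p X {} c) =
        homologous_rel_set p (discrete_topology {()}) {} (chain_map p (\<lambda>x. ()) c)"
      using c by (intro hom_induced_chain_map) auto
    also have "\<dots> = singular_relboundary_set p (discrete_topology {()}) {}"
      using c0 True by (simp add: homologous_rel_set_eq_relboundary)
    finally show ?thesis
      using car by (simp add: carrier_reduced_homology_group kernel_def)
  next
    case False
    then show ?thesis
      using car by (simp add: un_reduced_homology_group)
  qed
  then have "homologous_rel_set p X {} c = \<one>\<^bsub>reduced_homology_group (int p) X\<^esub>"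
    using triv by (auto simp: trivial_group_def)
  then show ?thesis
    by (simp add: one_reduced_homology_group homologous_rel_set_eq_relboundary)
qed

lemma antipodal_chains_exist:
  fixes X :: "'a topology"
  assumes a: "continuous_map X X a" "\<And>x. x \<in> topspace X \<Longrightarrow> a (a x) = x"
    and x0: "x0 \<in> topspace X"
    and triv: "\<And>p. p < n \<Longrightarrow> trivial_group (reduced_homology_group (int p) X)"
  obtains c where "c 0 = frag_of (\<lambda>t\<in>standard_simplex 0. x0)"
    and "\<And>k. k \<le> n \<Longrightarrow> singular_chain k X (c k)"
    and "\<And>k. k < n \<Longrightarrow> chain_boundary (Suc k) (c (Suc k)) =
      c k + frag_cmul ((-1) ^ Suc k) (chain_map k a (c k))"
proof -
  \<comment> \<open>The sign alternates with the degree so that \<open>S (Suc k) d\<close> is a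
    cycle whenever \<open>d\<close> has boundary \<open>S k e\<close>, \<open>a\<close> being an
    involution.\<close>
  define S where "S k c = c + frag_cmul ((-1) ^ Suc k) (chain_map k a c)" for k and c :: "'a chain"
  \<comment> \<open>Each chain is some filling of \<open>S k (c k)\<close>; the choice has its
    intended meaning only once a filling exists, which \<open>step\<close> supplies for
    \<open>k < n\<close>.\<close>
  define c where "c = rec_nat (frag_of (\<lambda>t\<in>standard_simplex 0. x0))
    (\<lambda>k c. SOME d. singular_chain (Suc k) X d \<and> chain_boundary (Suc k) d = S k c)"
  have c0: "c 0 = frag_of (\<lambda>t\<in>standard_simplex 0. x0)"
    by (simp add: c_def)
  have cSuc: "c (Suc k) = (SOME d. singular_chain (Suc k) X d \<and> chain_boundary (Suc k) d = S k (c k))" for k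
    by (simp add: c_def)
  have simp0: "singular_simplex 0 X (\<lambda>t\<in>standard_simplex 0. x0)"
    using x0 by (auto simp: singular_simplex_def continuous_map_const)
  have chS: "singular_chain k X (S k c)" if "singular_chain k X c" for k c
    using that unfolding S_def
    by (intro singular_chain_add singular_chain_cmul singular_chain_chain_map [OF _ a(1)])
  have inv: "chain_map k a (chain_map k a c) = c" if "singular_chain k X c" for k c
    using that chain_map_compose [of k a a] chain_map_id_gen [of k X c "a \<circ> a"] a(2)
    by (simp add: fun_eq_iff)
  have step: "singular_chain (Suc k) X (c (Suc k)) \<and> chain_boundary (Suc k) (c (Suc k)) = S k (c k)"
    if "k < n" "singular_relcycle k X {} (S k (c k))"
      "k = 0 \<Longrightarrow> chain_map 0 (\<lambda>x. ()) (S 0 (c 0)) = 0" for k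
  proof -
    have "singular_relboundary k X {} (S k (c k))"
      using that(2,3) by (auto intro: singular_boundary_if_trivial_reduced_homology [OF triv [OF that(1)]])
    then show ?thesis
      unfolding cSuc singular_boundary by (rule someI_ex)
  qed
  have main: "(\<forall>j\<le>k. singular_chain j X (c j)) \<and> (\<forall>j. k = Suc j \<longrightarrow> chain_boundary k (c k) = S j (c j))"
    if "k \<le> n" for k
    using that
  proof (induction k)
    case 0
    then show ?case
      by (simp add: c0 simp0 singular_chain_of)
  next
    case (Suc k)
    then have ch: "singular_chain k X (c k)"
      and bd: "\<And>j. k = Suc j \<Longrightarrow> chain_boundary k (c k) = S j (c j)"
      by auto
    have "chain_boundary k (S k (c k)) = 0"
    proof (cases k)
      case 0
      then show ?thesis
        by (simp add: chain_boundary_def)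
    next
      case (Suc j)
      define e :: int where "e = (-1) ^ Suc j"
      let ?d = "c j"
      have chj: "singular_chain j X ?d"
        using Suc.IH Suc.prems \<open>k = Suc j\<close> by simp
      have bdj: "chain_boundary (Suc j) (c (Suc j)) = S j (c j)"
        using bd [OF \<open>k = Suc j\<close>] \<open>k = Suc j\<close> by simp
      have "chain_boundary k (S k (c k)) = S j ?d + frag_cmul (- e) (chain_map j a (S j ?d))"
        using chain_boundary_chain_map [OF ch, of a]
        by (simp add: S_def [of "Suc j"] chain_boundary_add chain_boundary_cmul bdj \<open>k = Suc j\<close> e_def)
      also have "\<dots> = 0"
        by (simp add: S_def chain_map_add inv [OF chj] frag_cmul_distrib2 flip: e_def)
          (simp add: e_def flip: power_mult_distrib frag_cmul_distrib)
      finally show ?thesis .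
    qed
    then have "singular_relcycle k X {} (S k (c k))"
      using chS [OF ch] by (simp add: singular_cycle)
    \<comment> \<open>In degree 0 the sign is \<open>-1\<close>, so \<open>S 0 (c 0)\<close> is a
      difference of two points and vanishes when mapped to a single point.\<close>
    moreover have "chain_map 0 (\<lambda>x. ()) (S 0 (c 0)) = 0"
      by (simp add: S_def c0 chain_map_diff simplex_map_def)
    ultimately show ?case
      using step [of k] Suc by (auto simp: le_Suc_eq)
  qed
  show ?thesis
    using that [of c] c0 main by (auto simp: S_def)
qed

text \<open>The label of a point is the least \<open>i\<close> with \<open>x \<in> C i\<close> (sign \<open>+\<close>) or \<open>a x \<in> C i\<close> (sign \<open>-\<close>);
  if no \<open>C i\<close> contains both, then \<open>i = n\<close> does not occur, since both \<open>x\<close> and \<open>a x\<close> are covered.\<close>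
theorem lusternik_schnirelmann_closed:
  fixes X :: "'a topology" and C :: "nat \<Rightarrow> 'a set"
  assumes a: "continuous_map X X a" "\<And>x. x \<in> topspace X \<Longrightarrow> a (a x) = x"
    and ne: "topspace X \<noteq> {}"
    and triv: "\<And>p. p < n \<Longrightarrow> trivial_group (reduced_homology_group (int p) X)"
    and closed: "\<And>i. i \<le> n \<Longrightarrow> closedin X (C i)"
    and cover: "topspace X \<subseteq> (\<Union>i\<le>n. C i)"
  obtains i x where "i \<le> n" "x \<in> C i" "a x \<in> C i"
proof (rule ccontr)
  assume "\<not> thesis"
  then have disj: "a x \<notin> C i" if "i \<le> n" "x \<in> C i" for i x
    using that \<open>\<And>x i. i \<le> n \<Longrightarrow> x \<in> C i \<Longrightarrow> a x \<in> C i \<Longrightarrow> thesis\<close> by blast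
  have a_in: "a x \<in> topspace X" if "x \<in> topspace X" for x
    using continuous_map_image_subset_topspace [OF a(1)] that by blast
  define idx where "idx x = (LEAST i. x \<in> C i \<or> a x \<in> C i)" for x
  define lab where "lab x = 2 * idx x + of_bool (x \<notin> C (idx x))" for x
  have idx: "idx x \<le> n" "x \<in> C (idx x) \<or> a x \<in> C (idx x)" if x: "x \<in> topspace X" for x
  proof -
    obtain i where "i \<le> n" "x \<in> C i"
      using x cover by auto
    then show "x \<in> C (idx x) \<or> a x \<in> C (idx x)" "idx x \<le> n"
      using LeastI [of "\<lambda>i. x \<in> C i \<or> a x \<in> C i" i] Least_le [of "\<lambda>i. x \<in> C i \<or> a x \<in> C i" i]
      by (auto simp: idx_def)
  qed
  have idx_less: "idx x < n" if x: "x \<in> topspace X" for x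
  proof (rule ccontr)
    assume "\<not> idx x < n"
    then have "x \<notin> C i \<and> a x \<notin> C i" if "i < n" for i
      using that not_less_Least [of i "\<lambda>i. x \<in> C i \<or> a x \<in> C i"] by (simp add: idx_def)
    then have "x \<in> C n" "a x \<in> C n"
      using cover x a_in [OF x] by (metis UN_E atMost_iff le_neq_implies_less subsetD)+
    then show False
      using disj by blast
  qed
  have idx_a: "idx (a x) = idx x" if "x \<in> topspace X" for x
    by (simp add: idx_def a(2) that disj_commute)
  have lab_div: "lab x div 2 = idx x" for x
    by (simp add: lab_def)
  have lab_even: "even (lab x) \<longleftrightarrow> x \<in> C (idx x)" for x
    by (simp add: lab_def)
  have lab_less: "lab x < 2 * n" if "x \<in> topspace X" for x
    using idx_less [OF that] by (simp add: lab_def of_bool_def)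
  have lab_a: "lab (a x) = flip (lab x)" if x: "x \<in> topspace X" for x
    using idx [OF x] idx_a [OF x] disj [of "idx x"] by (auto simp: lab_def flip_def)
  have flip_div: "flip m div 2 = m div 2" for m
    by (auto simp: flip_def elim!: oddE)
  \<comment> \<open>A neighbourhood of \<open>x\<close> in which no new memberships arise: a point
    of \<open>V x\<close> lies in \<open>C i\<close> only if \<open>x\<close> does, and likewise for
    the antipodes.\<close>
  define V where "V x = {y \<in> topspace X. \<forall>i\<le>n. (x \<notin> C i \<longrightarrow> y \<notin> C i) \<and> (a x \<notin> C i \<longrightarrow> a y \<notin> C i)}" for x
  have "openin X (V x)" for x
  proof -
    have "V x = topspace X - (\<Union>i\<in>{i. i \<le> n \<and> x \<notin> C i}. C i)
        - (\<Union>i\<in>{i. i \<le> n \<and> a x \<notin> C i}. {y \<in> topspace X. a y \<in> C i})"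
      by (auto simp: V_def)
    moreover have "closedin X (\<Union>i\<in>{i. i \<le> n \<and> x \<notin> C i}. C i)"
      using closed by (intro closedin_Union) auto
    moreover have "closedin X (\<Union>i\<in>{i. i \<le> n \<and> a x \<notin> C i}. {y \<in> topspace X. a y \<in> C i})"
      using closed by (intro closedin_Union) (auto intro: closedin_continuous_map_preimage [OF a(1)])
    ultimately show ?thesis
      by (simp add: openin_diff)
  qed
  then have V_open: "openin X U" if "U \<in> V ` topspace X" for U
    using that by auto
  have V_cover: "topspace X \<subseteq> \<Union>(V ` topspace X)"
    by (auto simp: V_def)
  have V_flip: "lab z \<noteq> flip (lab y)" if "y \<in> V x" "z \<in> V x" for x y z
  proof
    assume eq: "lab z = flip (lab y)"
    have idx_eq: "idx z = idx y"
      using flip_div [of "lab y"] lab_div eq by metis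
    have yz: "y \<in> topspace X" "z \<in> topspace X"
      using that by (auto simp: V_def)
    have "(y \<in> C (idx y)) \<noteq> (z \<in> C (idx y))"
      using lab_even [of y] lab_even [of z] idx_eq eq by auto
    \<comment> \<open>One of \<open>y\<close>, \<open>z\<close> lies in the common set
      \<open>C (idx y)\<close> and the antipode of the other does; both memberships pass to
      \<open>x\<close>.\<close>
    then have "x \<in> C (idx y)" "a x \<in> C (idx y)"
      using that idx [OF yz(1)] idx [OF yz(2)] idx_eq by (auto simp: V_def)
    then show False
      using disj idx(1) [OF yz(1)] by blast
  qed
  obtain x0 where x0: "x0 \<in> topspace X"
    using ne by blast
  obtain c where c0: "c 0 = frag_of (\<lambda>t\<in>standard_simplex 0. x0)"
    and c: "\<And>k. k \<le> n \<Longrightarrow> singular_chain k X (c k)"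
    and bd: "\<And>k. k < n \<Longrightarrow> chain_boundary (Suc k) (c (Suc k)) =
      c k + frag_cmul ((-1) ^ Suc k) (chain_map k a (c k))"
    using antipodal_chains_exist [OF a x0 triv] by metis
  have "\<forall>k. \<exists>m. k \<le> n \<longrightarrow> (\<forall>m' f. m \<le> m' \<longrightarrow> f \<in> Poly_Mapping.keys ((singular_subdivision k ^^ m') (c k)) \<longrightarrow>
      (\<exists>U \<in> V ` topspace X. f \<in> standard_simplex k \<rightarrow> U))"
  proof
    fix k
    show "\<exists>m. k \<le> n \<longrightarrow> (\<forall>m' f. m \<le> m' \<longrightarrow> f \<in> Poly_Mapping.keys ((singular_subdivision k ^^ m') (c k)) \<longrightarrow>
      (\<exists>U \<in> V ` topspace X. f \<in> standard_simplex k \<rightarrow> U))"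
    proof (cases "k \<le> n")
      case True
      show ?thesis
        by (rule sufficient_iterated_singular_subdivision_exists [OF V_open V_cover c [OF True]]) blast+
    qed auto
  qed
  then obtain m where m: "\<And>k m' f. \<lbrakk>k \<le> n; m k \<le> m'; f \<in> Poly_Mapping.keys ((singular_subdivision k ^^ m') (c k))\<rbrakk>
      \<Longrightarrow> \<exists>U \<in> V ` topspace X. f \<in> standard_simplex k \<rightarrow> U"
    by metis
  \<comment> \<open>One depth of subdivision serves all degrees, so that the boundary relations
    between the chains survive.\<close>
  define M where "M = Max (m ` {..n})"
  define d where "d k = (singular_subdivision k ^^ M) (c k)" for k
  have d_small: "\<exists>x. f ` standard_simplex k \<subseteq> V x" if "k \<le> n" "f \<in> Poly_Mapping.keys (d k)" for k f
    using m [of k M f] that by (force simp: M_def d_def)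
  have d_labels: "l < 2 * n \<and> flip l \<notin> set (vertex_labels lab k f)"
    if k: "k \<le> n" and f: "f \<in> Poly_Mapping.keys (d k)" and l: "l \<in> set (vertex_labels lab k f)" for k f l
  proof -
    obtain x where x: "f ` standard_simplex k \<subseteq> V x"
      using d_small [OF k f] by blast
    then have sub: "set (vertex_labels lab k f) \<subseteq> lab ` V x"
      using set_vertex_labels_subset by fast
    then obtain y where y: "y \<in> V x" "l = lab y"
      using l by blast
    have "flip l \<notin> lab ` V x"
      using V_flip [OF y(1)] y(2) by (metis imageE)
    then have "flip l \<notin> set (vertex_labels lab k f)"
      using sub by blast
    moreover have "l < 2 * n"
      using l sub lab_less by (auto simp: V_def)
    ultimately show ?thesis
      by simp
  qed
  have d_a: "vertex_labels (lab \<circ> a) k f = map flip (vertex_labels lab k f)"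
    if k: "k \<le> n" and f: "f \<in> Poly_Mapping.keys (d k)" for k f
  proof -
    have "f (\<lambda>i. if i = j then 1 else 0) \<in> topspace X" if "j \<le> k" for j
    proof -
      have "f (\<lambda>i. if i = j then 1 else 0) \<in> f ` standard_simplex k"
        using that by (intro imageI) simp
      then show ?thesis
        using d_small [OF k f] unfolding V_def by blast
    qed
    then show ?thesis
      by (auto simp: vertex_labels_def lab_a)
  qed
  have d_bd: "chain_boundary (Suc k) (d (Suc k)) = d k + frag_cmul ((-1) ^ Suc k) (chain_map k a (d k))"
    if "k < n" for k
  proof -
    have "chain_boundary (Suc k) (d (Suc k)) = (singular_subdivision k ^^ M) (chain_boundary (Suc k) (c (Suc k)))"
      unfolding d_def using that by (intro chain_boundary_iterated_subdivision [OF c]) simp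
    also have "\<dots> = d k + frag_cmul ((-1) ^ Suc k) (chain_map k a (d k))"
      using that iterated_subdivision_chain_map [OF c, of k M a]
      by (simp only: bd iterated_subdivision_add iterated_subdivision_cmul d_def)
    finally show ?thesis .
  qed
  \<comment> \<open>Both starting signs are counted together. The boundary of
    \<open>d (Suc k)\<close> is \<open>d k\<close> plus or minus its antipodal image, in which the
    starting signs are exchanged; so its count for \<open>True\<close> has the parity of both counts
    in \<open>d k\<close>, and this parity passes to \<open>d (Suc k)\<close>.\<close>
  have "odd (alternating_count lab True k (d k) + alternating_count lab False k (d k))" if "k \<le> n" for k
    using that
  proof (induction k)
    case 0
    \<comment> \<open>A single labelled point is alternating for exactly one starting sign.\<close>
    have "d 0 = c 0"
      using iterated_subdivision_zero [OF c [of 0]] by (simp add: d_def)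
    then show ?case
      by (simp add: c0 alternating_simplex_def vertex_labels_def)
  next
    case (Suc k)
    have "alternating_count lab True k (chain_map k a (d k)) = alternating_count lab False k (d k)"
      using Suc.prems alternating_count_chain_map [of "d k" lab k a True] d_labels [of k] d_a [of k] by simp
    then have "even (alternating_count lab True k (d k)
        + (- 1) ^ Suc k * alternating_count lab False k (d k)
        + alternating_count lab True (Suc k) (d (Suc k)) + alternating_count lab False (Suc k) (d (Suc k)))"
      using even_alternating_count_boundary [of lab True k "d (Suc k)"] Suc.prems
      by (simp add: d_bd alternating_count_add)
    then show ?case
      using Suc by (cases "even k") auto
  qed
  moreover have "alternating_count lab b n (d n) = 0" for b
    using d_labels by (intro alternating_count_eq_0) auto
  ultimately show False
    by force
qed

section \<open>Open covers of Euclidean spheres\<close>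

lemma trivial_reduced_homology_group_sphere:
  assumes "p \<noteq> DIM('a) - 1"
  shows "trivial_group (reduced_homology_group (int p) (top_of_set (sphere (0::'a::euclidean_space) 1)))"
proof -
  obtain f :: "(nat \<Rightarrow> real) \<Rightarrow> 'a" and g
    where "homeomorphic_maps (nsphere (DIM('a) - 1)) (top_of_set (sphere 0 1 \<inter> span Basis)) f g"
    by (rule homeomorphic_maps_nsphere_euclidean_sphere
        [OF independent_Basis _ refl _ norm_Basis])
      (auto simp: pairwise_def orthogonal_def inner_Basis)
  then have "nsphere (DIM('a) - 1) homeomorphic_space top_of_set (sphere (0::'a) 1)"
    unfolding homeomorphic_space_def by auto
  then show ?thesis
    using assms trivial_reduced_homology_group_nsphere [of "int p" "DIM('a) - 1"]
      isomorphic_group_triviality [OF homeomorphic_space_imp_isomorphic_reduced_homology_groups]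
    by (metis group_reduced_homology_group of_nat_eq_iff)
qed

text \<open>The cover is shrunk to closed sets: \<open>C i\<close> consists of the points whose
  distance to the complement of \<open>U i\<close> is the largest among all indices. This maximum is
  positive because some \<open>U j\<close> contains the point, so \<open>C i\<close> lies in
  \<open>U i\<close>.\<close>

theorem lusternik_schnirelmann_open:
  fixes U :: "nat \<Rightarrow> 'a::euclidean_space set"
  assumes U: "\<And>i. i < DIM('a) \<Longrightarrow> open (U i)" and cover: "sphere 0 1 \<subseteq> (\<Union>i<DIM('a). U i)"
  obtains i x where "i < DIM('a)" "norm x = 1" "x \<in> U i" "-x \<in> U i"
proof (cases "\<exists>i<DIM('a). U i = UNIV")
  case True
  obtain b :: 'a where "b \<in> Basis"
    using nonempty_Basis by blast
  with True show ?thesis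
    using that [of _ b] by auto
next
  case False
  \<comment> \<open>The distance to an empty set is 0 by convention, hence the separate case
    \<open>U i = UNIV\<close>.\<close>
  define f where "f i x = infdist x (- U i)" for i and x :: 'a
  have f_pos: "x \<in> U i" if "i < DIM('a)" "f i x > 0" for i x
    using that by (metis Compl_iff f_def infdist_zero less_irrefl)
  have pos_f: "f i x > 0" if "i < DIM('a)" "x \<in> U i" for i x
    unfolding f_def using that U False
    by (intro infdist_pos_not_in_closed) (auto simp: closed_Compl)
  define C where "C i = {x \<in> sphere 0 1. \<forall>j<DIM('a). f j x \<le> f i x}" for i
  have C_U: "x \<in> U i" if i: "i < DIM('a)" and x: "x \<in> C i" for i x
  proof -
    have "x \<in> (\<Union>i<DIM('a). U i)"
      using x cover unfolding C_def by blast
    then obtain j where "j < DIM('a)" "x \<in> U j"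
      by blast
    then have "0 < f j x" "f j x \<le> f i x"
      using pos_f x by (auto simp: C_def)
    then show ?thesis
      using f_pos [OF i, of x] by linarith
  qed
  have "closed (C i)" for i
  proof -
    have "C i = sphere 0 1 \<inter> (\<Inter>j\<in>{..<DIM('a)}. {x. f j x \<le> f i x})"
      by (auto simp: C_def)
    then show ?thesis
      unfolding f_def by (auto intro!: closed_Int closed_INT closed_Collect_le continuous_intros)
  qed
  then have C_closed: "closedin (top_of_set (sphere 0 1)) (C i)" for i
    by (rule closed_subset [rotated]) (auto simp: C_def)
  \<comment> \<open>The \<open>DIM('a)\<close> sets have indices up to \<open>DIM('a) - 1\<close>,
    the dimension of the sphere; the homology must vanish strictly below that degree.\<close>
  have C_cover: "topspace (top_of_set (sphere 0 1)) \<subseteq> (\<Union>i\<le>DIM('a) - 1. C i)"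
  proof
    fix x :: 'a assume x: "x \<in> topspace (top_of_set (sphere 0 1))"
    have "finite {..<DIM('a)}" "{..<DIM('a)} \<noteq> {}"
      using DIM_positive [where 'a='a] by (auto simp: lessThan_empty_iff)
    then obtain i where i: "i \<in> {..<DIM('a)}" "Max ((\<lambda>i. f i x) ` {..<DIM('a)}) = f i x"
      by (rule obtains_MAX)
    have "f j x \<le> f i x" if "j < DIM('a)" for j
      unfolding i(2) [symmetric] using that by (intro Max_ge) auto
    then have "i < DIM('a)" "x \<in> C i"
      using x i(1) by (auto simp: C_def)
    then show "x \<in> (\<Union>i\<le>DIM('a) - 1. C i)"
      by (intro UN_I [of i]) auto
  qed
  have cont: "continuous_map (top_of_set (sphere 0 1)) (top_of_set (sphere 0 1)) (uminus :: 'a \<Rightarrow> 'a)"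
    by (auto intro!: continuous_intros)
  have ne: "topspace (top_of_set (sphere (0::'a) 1)) \<noteq> {}"
    by simp
  have triv: "trivial_group (reduced_homology_group (int p) (top_of_set (sphere (0::'a) 1)))"
    if "p < DIM('a) - 1" for p
    using that by (intro trivial_reduced_homology_group_sphere) simp
  obtain i x where ix: "i \<le> DIM('a) - 1" "x \<in> C i" "-x \<in> C i"
    by (rule lusternik_schnirelmann_closed [OF cont _ ne triv C_closed C_cover]) auto
  then have "i < DIM('a)"
    using DIM_positive [where 'a='a] by linarith
  then show ?thesis
    using that [of i x] ix C_U by (auto simp: C_def)
qed

subsection \<open>Self-polar polytopes\<close>

lemma mem_self_polar:
  assumes "P = uminus ` polar P"
  shows "x \<in> P \<longleftrightarrow> (\<forall>p\<in>P. x \<bullet> p \<ge> -1)"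
proof -
  have "x \<in> P \<longleftrightarrow> -x \<in> polar P"
    by (subst assms) force
  then show ?thesis
    by (simp add: polar_def)
qed

text \<open>\<open>W\<close> collects the vertices of positive weight in a convex representation of
  \<open>y\<close> and stands in for the smallest face containing \<open>y\<close>. A weighted mean
  of the nonnegative numbers \<open>v \<bullet> q + 1\<close> vanishes only if each of these terms
  does.\<close>

lemma extreme_support:
  fixes P :: "'a::euclidean_space set"
  assumes P: "polytope P" and y: "y \<in> P"
  obtains W where "W \<subseteq> {v. v extreme_point_of P}" "W \<noteq> {}" "y \<in> convex hull W"
    "\<And>q. \<lbrakk>\<And>v. v extreme_point_of P \<Longrightarrow> v \<bullet> q \<ge> -1; y \<bullet> q = -1\<rbrakk> \<Longrightarrow> \<forall>w\<in>W. w \<bullet> q = -1"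
proof -
  define V where "V = {v. v extreme_point_of P}"
  have fin: "finite V"
    using P by (simp add: V_def finite_polyhedron_extreme_points polytope_imp_polyhedron)
  have "P = convex hull V"
    using P unfolding V_def by (intro Krein_Milman_Minkowski polytope_imp_compact polytope_imp_convex)
  then obtain u where u: "\<And>v. v \<in> V \<Longrightarrow> 0 \<le> u v" "sum u V = 1" "(\<Sum>v\<in>V. u v *\<^sub>R v) = y"
    using y convex_hull_finite [OF fin] by auto
  define W where "W = {v \<in> V. u v \<noteq> 0}"
  have WV: "W \<subseteq> V" "finite W"
    using fin by (auto simp: W_def)
  have "sum u V = sum u W" "(\<Sum>v\<in>V. u v *\<^sub>R v) = (\<Sum>v\<in>W. u v *\<^sub>R v)"
    by (rule sum.mono_neutral_right [OF fin WV(1)]; simp add: W_def)+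
  then have sum1: "sum u W = 1" and sumy: "(\<Sum>v\<in>W. u v *\<^sub>R v) = y"
    using u(2,3) by simp_all
  show ?thesis
  proof
    show "W \<subseteq> {v. v extreme_point_of P}"
      using WV by (simp add: V_def)
    show "W \<noteq> {}"
      using sum1 by auto
    show "y \<in> convex hull W"
      using sum1 sumy u(1) WV by (auto simp: convex_hull_finite)
    fix q assume q: "\<And>v. v extreme_point_of P \<Longrightarrow> v \<bullet> q \<ge> -1" "y \<bullet> q = -1"
    have "(\<Sum>v\<in>W. u v * (v \<bullet> q + 1)) = (\<Sum>v\<in>W. u v *\<^sub>R v) \<bullet> q + sum u W"
      by (simp add: algebra_simps sum.distrib inner_sum_left)
    then have "(\<Sum>v\<in>W. u v * (v \<bullet> q + 1)) = 0"
      using sum1 sumy q by simp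
    moreover have "u v * (v \<bullet> q + 1) \<ge> 0" if "v \<in> W" for v
      using q(1) [of v] u(1) [of v] that WV by (auto simp: V_def)
    ultimately have "\<forall>v\<in>W. u v * (v \<bullet> q + 1) = 0"
      by (subst sum_nonneg_eq_0_iff [OF WV(2), symmetric]) auto
    then show "\<forall>w\<in>W. w \<bullet> q = -1"
      by (auto simp: W_def)
  qed
qed

section \<open>The self-dual cone over a self-polar set\<close>

text \<open>The dual of the cone spanned by the points \<open>(p, 1)\<close>. For bounded
  \<open>P = - polar P\<close> it is that cone itself, by
  \<open>homogenization_cases\<close>.\<close>

definition homogenization :: "'a::real_inner set \<Rightarrow> ('a \<times> real) set" where
  "homogenization P = {z. \<forall>p\<in>P. fst z \<bullet> p + snd z \<ge> 0}"

lemma homogenization_eq_Inter: "homogenization P = (\<Inter>p\<in>P. {z. (p, 1) \<bullet> z \<ge> 0})"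
  by (auto simp: homogenization_def inner_prod_def inner_commute)

lemma closed_homogenization: "closed (homogenization P)"
  and convex_homogenization: "convex (homogenization P)"
  unfolding homogenization_eq_Inter
  by (auto intro!: closed_INT closed_halfspace_ge convex_INT convex_halfspace_ge)

lemma homogenization_scaleR:
  assumes "z \<in> homogenization P" "t \<ge> 0"
  shows "t *\<^sub>R z \<in> homogenization P"
proof -
  have "fst (t *\<^sub>R z) \<bullet> p + snd (t *\<^sub>R z) = t * (fst z \<bullet> p + snd z)" for p
    by (simp add: algebra_simps)
  then show ?thesis
    using assms by (auto simp: homogenization_def)
qed

lemma homogenization_cases:
  fixes P :: "'a::real_inner set"
  assumes P: "P = uminus ` polar P" "bounded P"
    and z: "z \<in> homogenization P" "z \<noteq> 0"
  obtains t y where "t > 0" "y \<in> P" "z = (t *\<^sub>R y, t)"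
proof -
  have "0 \<in> P"
    by (subst mem_self_polar [OF P(1)]) simp
  then have "snd z \<ge> 0"
    using z(1) by (force simp: homogenization_def)
  moreover have "snd z \<noteq> 0"
  proof
    assume s: "snd z = 0"
    then have "fst z \<noteq> 0"
      using z(2) by (auto simp: prod_eq_iff)
    obtain B where B: "\<And>p. p \<in> P \<Longrightarrow> norm p \<le> B" "B > 0"
      using P(2) bounded_pos by blast
    \<comment> \<open>At height 0 the whole ray through \<open>fst z\<close> would lie in
      \<open>P\<close>; this multiple has norm \<open>B + 1\<close>, beyond the bound.\<close>
    have "((B + 1) / norm (fst z)) *\<^sub>R fst z \<in> P"
    proof (subst mem_self_polar [OF P(1)], rule ballI)
      fix p assume "p \<in> P"
      then have "0 \<le> (B + 1) / norm (fst z) * (fst z \<bullet> p)"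
        using z(1) s B(2) by (simp add: homogenization_def)
      then show "- 1 \<le> ((B + 1) / norm (fst z)) *\<^sub>R fst z \<bullet> p"
        by simp
    qed
    then show False
      using B \<open>fst z \<noteq> 0\<close> by fastforce
  qed
  ultimately have pos: "snd z > 0"
    by simp
  have "(1 / snd z) *\<^sub>R fst z \<in> P"
  proof (subst mem_self_polar [OF P(1)], rule ballI)
    fix p assume "p \<in> P"
    then show "-1 \<le> (1 / snd z) *\<^sub>R fst z \<bullet> p"
      using z(1) pos by (auto simp: homogenization_def field_simps)
  qed
  then show ?thesis
    using that [OF pos] pos by (simp add: prod_eq_iff)
qed

lemma homogenization_inner_nonneg:
  fixes P :: "'a::real_inner set"
  assumes P: "P = uminus ` polar P" "bounded P"
    and z: "z \<in> homogenization P" "z' \<in> homogenization P"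
  shows "z \<bullet> z' \<ge> 0"
proof (cases "z = 0 \<or> z' = 0")
  case False
  then obtain t y t' y' where *: "t > 0" "y \<in> P" "z = (t *\<^sub>R y, t)" "t' > 0" "y' \<in> P" "z' = (t' *\<^sub>R y', t')"
    using homogenization_cases [OF P] z by metis
  then have "z \<bullet> z' = t * t' * (y \<bullet> y' + 1)"
    by (simp add: inner_prod_def algebra_simps)
  moreover have "y \<bullet> y' \<ge> -1"
    using * mem_self_polar [OF P(1), of y] by blast
  ultimately show ?thesis
    using * by simp
qed auto

text \<open>Moreau's decomposition \<open>u = a - b\<close> for the cone over \<open>P\<close>, which is self-dual because
  \<open>P = - polar P\<close>.\<close>
lemma homogenization_decomposition:
  fixes P :: "'a::euclidean_space set" and u :: "'a \<times> real"
  assumes P: "P = uminus ` polar P"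
  defines "a \<equiv> closest_point (homogenization P) u"
  shows "a \<in> homogenization P" "a - u \<in> homogenization P" "a \<bullet> (a - u) = 0"
proof -
  have 0: "0 \<in> homogenization P"
    by (simp add: homogenization_def)
  show a: "a \<in> homogenization P"
    unfolding a_def using 0 closed_homogenization by (intro closest_point_in_set) auto
  have dot: "(u - a) \<bullet> (z - a) \<le> 0" if "z \<in> homogenization P" for z
    unfolding a_def using that closed_homogenization convex_homogenization by (intro closest_point_dot)
  \<comment> \<open>The variational inequality of the projection, tested at \<open>0\<close> and at
    \<open>2 a\<close>, gives both signs.\<close>
  show orth: "a \<bullet> (a - u) = 0"
    using dot [OF 0] dot [OF homogenization_scaleR [OF a, of 2]]
    by (simp add: inner_commute algebra_simps scaleR_2)
  show "a - u \<in> homogenization P"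
    unfolding homogenization_def
  proof (intro CollectI ballI)
    fix p assume "p \<in> P"
    then have "\<forall>q\<in>P. p \<bullet> q \<ge> -1"
      by (simp only: mem_self_polar [OF P, of p])
    \<comment> \<open>Self-polarity places \<open>(p, 1)\<close> in the cone, so it too may be
      tested.\<close>
    then have "(p, 1) \<in> homogenization P"
      by (force simp: homogenization_def)
    from dot [OF this] orth have "0 \<le> (a - u) \<bullet> (p, 1)"
      by (simp add: inner_commute algebra_simps)
    then show "0 \<le> fst (a - u) \<bullet> p + snd (a - u)"
      by (simp add: inner_prod_def)
  qed
qed

text \<open>Uniqueness of Moreau's decomposition: \<open>- u\<close> is the difference of
  \<open>a - u\<close> and \<open>a\<close>, the orthogonal parts for \<open>u\<close> with their
  roles exchanged.\<close>

lemma closest_point_homogenization_minus: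
  fixes P :: "'a::euclidean_space set" and u :: "'a \<times> real"
  assumes P: "P = uminus ` polar P" "bounded P"
  shows "closest_point (homogenization P) (- u) = closest_point (homogenization P) u - u"
proof -
  define a a' where "a = closest_point (homogenization P) u"
    and "a' = closest_point (homogenization P) (- u)"
  note a = homogenization_decomposition [OF P(1), of u, folded a_def]
  note a' = homogenization_decomposition [OF P(1), of "- u", folded a'_def]
  \<comment> \<open>The two ways of grouping the same vector turn its squared norm into two
    vanishing orthogonality terms minus two nonnegative inner products.\<close>
  have "(a - u - a') \<bullet> (a - u - a') = (a - (a' + u)) \<bullet> ((a - u) - a')"
    by (simp add: algebra_simps)
  also have "\<dots> = a \<bullet> (a - u) + a' \<bullet> (a' + u) - a \<bullet> a' - (a - u) \<bullet> (a' + u)"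
    by (simp add: inner_diff_left inner_diff_right inner_add_left inner_add_right inner_commute)
  also have "\<dots> \<le> 0"
    using a a' homogenization_inner_nonneg [OF P, of a a'] homogenization_inner_nonneg [OF P, of "a - u" "a' + u"]
    by simp
  finally have "a - u - a' = 0"
    by (metis inner_eq_zero_iff inner_ge_zero order_antisym)
  then show ?thesis
    by (simp add: a_def a'_def)
qed

section \<open>Colourings of the graph\<close>

theorem not_colourable_self_polar:
  fixes P :: "'a::euclidean_space set"
  assumes poly: "polytope P" and self: "P = uminus ` polar P"
  shows "\<not> colourable (polytope_graph P) DIM('a)"
proof
  assume "colourable (polytope_graph P) DIM('a)"
  then obtain c :: "'a \<Rightarrow> nat" where c: "\<And>v. v extreme_point_of P \<Longrightarrow> c v < DIM('a)"
    and proper: "\<And>v w. \<lbrakk>v extreme_point_of P; w extreme_point_of P; v \<bullet> w = -1\<rbrakk> \<Longrightarrow> c v \<noteq> c w"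
    by (auto simp: colourable_def proper_colouring_def polytope_graph_def image_subset_iff)
  define V where "V = {v. v extreme_point_of P}"
  have finV: "finite V"
    using poly by (simp add: V_def finite_polyhedron_extreme_points polytope_imp_polyhedron)
  have ext_P: "v \<in> P" if "v extreme_point_of P" for v
    using that by (simp add: extreme_point_of_def)
  then have VP: "v \<in> P" if "v \<in> V" for v
    using that by (simp add: V_def)
  have ge: "x \<bullet> p \<ge> -1" if "x \<in> P" "p \<in> P" for x p
    using that mem_self_polar [OF self, of x] by blast
  have bdd: "bounded P"
    using poly by (rule polytope_imp_bounded)
  \<comment> \<open>The sphere enters as the horizontal directions \<open>(x, 0)\<close>. Since
    \<open>A x\<close> and \<open>A (- x)\<close> differ by \<open>(x, 0)\<close>, they have equal
    height \<open>t\<close>, and \<open>x = t (y - y')\<close> for the points \<open>y\<close>,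
    \<open>y'\<close> of \<open>P\<close> below them.\<close>
  define A where "A x = closest_point (homogenization P) (x, 0)" for x :: 'a
  have cont: "continuous_on UNIV (\<lambda>x. closest_point (homogenization P) (x, 0::real))"
    by (intro continuous_on_compose2 [OF continuous_on_closest_point [of _ UNIV]] convex_homogenization
        closed_homogenization continuous_intros) (auto simp: homogenization_def intro!: exI [of _ 0])
  have A: "A x \<in> homogenization P" "A x - (x, 0) \<in> homogenization P" "A x \<bullet> (A x - (x, 0)) = 0"
    "A (- x) = A x - (x, 0)" for x
    using homogenization_decomposition [OF self] closest_point_homogenization_minus [OF self bdd, of "(x, 0)"]
    by (auto simp: A_def)
  have A_nonzero: "A x \<noteq> 0" if "x \<noteq> 0" for x
  proof
    assume "A x = 0"
    then have "(- x, 0) \<in> homogenization P"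
      using A(2) [of x] by (simp add: zero_prod_def)
    then show False
      using that by (elim homogenization_cases [OF self bdd]) (auto simp: zero_prod_def)
  qed
  \<comment> \<open>For \<open>A x = (t y, t)\<close> the equation says
    \<open>y \<bullet> w = -1\<close>. So some vertex of colour \<open>i\<close> lies on every
    hyperplane \<open>z \<bullet> w = -1\<close> through \<open>y\<close> that comes from a vertex
    \<open>w\<close>, that is, in the smallest face containing \<open>y\<close>. In this form
    openness is visible.\<close>
  define U where "U i = {x. \<exists>v\<in>V. c v = i \<and> (\<forall>w\<in>V. fst (A x) \<bullet> w + snd (A x) = 0 \<longrightarrow> v \<bullet> w = -1)}" for i
  have "open (U i)" for i
  proof -
    have "U i = (\<Union>v\<in>{v \<in> V. c v = i}. \<Inter>w\<in>{w \<in> V. v \<bullet> w \<noteq> -1}. {x. fst (A x) \<bullet> w + snd (A x) \<noteq> 0})"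
      by (auto simp: U_def)
    then show ?thesis
      using finV unfolding A_def by (auto intro!: open_UN open_INT open_Collect_neq continuous_intros cont)
  qed
  moreover have "sphere 0 1 \<subseteq> (\<Union>i<DIM('a). U i)"
  proof
    fix x :: 'a assume "x \<in> sphere 0 1"
    then have "A x \<noteq> 0"
      by (intro A_nonzero) auto
    then obtain t y where ty: "t > 0" "y \<in> P" "A x = (t *\<^sub>R y, t)"
      by (rule homogenization_cases [OF self bdd A(1)])
    \<comment> \<open>Any vertex of positive weight in \<open>y\<close> puts \<open>x\<close> into
      the set of its own colour.\<close>
    obtain W where W: "W \<subseteq> V" "W \<noteq> {}"
      "\<And>q. \<lbrakk>\<And>v. v extreme_point_of P \<Longrightarrow> v \<bullet> q \<ge> -1; y \<bullet> q = -1\<rbrakk> \<Longrightarrow> \<forall>w\<in>W. w \<bullet> q = -1"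
      using extreme_support [OF poly ty(2)] unfolding V_def by metis
    then obtain v where v: "v \<in> W" "v \<in> V"
      by auto
    have "v \<bullet> w = -1" if w: "w \<in> V" "fst (A x) \<bullet> w + snd (A x) = 0" for w
    proof -
      have "t * (y \<bullet> w + 1) = 0"
        using w(2) ty(3) by (simp add: algebra_simps)
      then have "y \<bullet> w = -1"
        using ty(1) by simp
      then show ?thesis
        using W(3) [OF ge [OF ext_P VP [OF w(1)]]] v(1) by blast
    qed
    then have "x \<in> U (c v)"
      using v by (auto simp: U_def)
    then show "x \<in> (\<Union>i<DIM('a). U i)"
      using c v by (auto simp: V_def)
  qed
  ultimately obtain i x where x: "norm x = 1" "x \<in> U i" "-x \<in> U i"
    by (rule lusternik_schnirelmann_open)
  then obtain v v' where v: "v \<in> V" "c v = i" "\<And>w. \<lbrakk>w \<in> V; fst (A x) \<bullet> w + snd (A x) = 0\<rbrakk> \<Longrightarrow> v \<bullet> w = -1"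
    and v': "v' \<in> V" "c v' = i" "\<And>w. \<lbrakk>w \<in> V; fst (A (-x)) \<bullet> w + snd (A (-x)) = 0\<rbrakk> \<Longrightarrow> v' \<bullet> w = -1"
    by (auto simp: U_def)
  have "x \<noteq> 0"
    using x(1) by auto
  obtain t y where ty: "t > 0" "y \<in> P" "A x = (t *\<^sub>R y, t)"
    by (rule homogenization_cases [OF self bdd A(1) A_nonzero [OF \<open>x \<noteq> 0\<close>]])
  obtain t' y' where ty': "t' > 0" "y' \<in> P" "A (- x) = (t' *\<^sub>R y', t')"
    using \<open>x \<noteq> 0\<close> by (auto intro: homogenization_cases [OF self bdd A(1) A_nonzero [of "- x"]])
  \<comment> \<open>The two parts of the decomposition are orthogonal and have positive heights,
    which forces \<open>y' \<bullet> y = -1\<close>.\<close>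
  have "A x \<bullet> A (- x) = t * t' * (y' \<bullet> y + 1)"
    by (simp add: ty ty' inner_prod_def algebra_simps inner_commute)
  then have "y' \<bullet> y = -1"
    using A(3,4) [of x] ty ty' by simp
  obtain W where W: "W \<subseteq> V" "y' \<in> convex hull W"
    "\<And>q. \<lbrakk>\<And>v. v extreme_point_of P \<Longrightarrow> v \<bullet> q \<ge> -1; y' \<bullet> q = -1\<rbrakk> \<Longrightarrow> \<forall>w\<in>W. w \<bullet> q = -1"
    using extreme_support [OF poly ty'(2)] unfolding V_def by metis
  have W_y: "\<forall>w\<in>W. w \<bullet> y = -1"
    using \<open>y' \<bullet> y = -1\<close> by (intro W(3) ge [OF ext_P ty(2)])
  have "v \<bullet> w = -1" if "w \<in> W" for w
  proof (rule v(3))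
    show "w \<in> V"
      using W(1) that by auto
    have "y \<bullet> w = -1"
      using W_y that by (simp add: inner_commute)
    then show "fst (A x) \<bullet> w + snd (A x) = 0"
      using ty by simp
  qed
  \<comment> \<open>From the vertices carrying \<open>y'\<close> the equation extends to
    \<open>y'\<close> itself. Then \<open>v\<close> is among the vertices to which \<open>v'\<close>
    is adjacent, although both have colour \<open>i\<close>.\<close>
  then have "convex hull W \<subseteq> {z. v \<bullet> z = -1}"
    by (intro hull_minimal convex_hyperplane) auto
  then have "v \<bullet> y' = -1"
    using W(2) by auto
  then have "y' \<bullet> v = -1"
    by (simp add: inner_commute)
  then have "v' \<bullet> v = -1"
    using v(1) ty' by (intro v'(3)) auto
  then show False
    using proper v v' by (auto simp: V_def)
qed

section \<open>Cliques and simplices\<close>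

text \<open>By \<open>dot\<close>, inner products with the vertices of a clique determine the
  coefficients of an affine combination. This makes \<open>K\<close> affinely independent, hence
  spanning by its size, and the inequalities defining \<open>P\<close> become nonnegativity of
  barycentric coordinates.\<close>

lemma clique_imp_simplex:
  fixes P :: "'a::euclidean_space set"
  assumes self: "P = uminus ` polar P" and P: "convex P"
    and K: "clique (polytope_graph P) (DIM('a) + 1) K"
  shows "int DIM('a) simplex P"
proof -
  have fin: "finite K" and card: "card K = DIM('a) + 1"
    using K by (auto simp: clique_def)
  have KP: "v \<in> P" if "v \<in> K" for v
    using K that by (auto simp: clique_def polytope_graph_def extreme_point_of_def)
  have inner: "v \<bullet> w = -1" if "v \<in> K" "w \<in> K" "v \<noteq> w" for v w
    using K that by (auto simp: clique_def polytope_graph_def)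
  have dot: "(\<Sum>v\<in>K. u v *\<^sub>R v) \<bullet> w = u w * (w \<bullet> w + 1) - sum u K" if w: "w \<in> K" for u w
  proof -
    have "(\<Sum>v\<in>K. u v *\<^sub>R v) \<bullet> w = (\<Sum>v\<in>K. (if v = w then u w * (w \<bullet> w + 1) else 0) - u v)"
      unfolding inner_sum_left by (rule sum.cong) (auto simp: inner w algebra_simps)
    also have "\<dots> = u w * (w \<bullet> w + 1) - sum u K"
      using fin w by (simp add: sum_subtractf)
    finally show ?thesis .
  qed
  have pos: "w \<bullet> w + 1 > 0" for w :: 'a
    using inner_ge_zero [of w] by linarith
  have indep: "\<not> affine_dependent K"
    unfolding affine_dependent_explicit_finite [OF fin]
  proof (intro notI, elim exE conjE)
    fix u assume u: "sum u K = 0" "\<exists>v\<in>K. u v \<noteq> 0" "(\<Sum>v\<in>K. u v *\<^sub>R v) = 0"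
    then show False
      using dot [of _ u] pos by (metis diff_zero inner_zero_left less_irrefl mult_eq_0_iff)
  qed
  have "aff_dim K = int DIM('a)"
    using aff_dim_affine_independent [OF indep] card by simp
  then have "affine hull K = UNIV"
    using aff_dim_eq_full by blast
  have "P \<subseteq> convex hull K"
  proof
    fix x assume "x \<in> P"
    obtain u where u: "sum u K = 1" "(\<Sum>v\<in>K. u v *\<^sub>R v) = x"
      using \<open>affine hull K = UNIV\<close> affine_hull_finite [OF fin] by blast
    have "u w \<ge> 0" if "w \<in> K" for w
    proof -
      have "x \<bullet> w \<ge> -1"
        using \<open>x \<in> P\<close> KP [OF that] mem_self_polar [OF self, of x] by blast
      then have "u w * (w \<bullet> w + 1) \<ge> 0"
        using dot [OF that, of u] u by simp
      then show ?thesis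
        using pos [of w] by (simp add: zero_le_mult_iff)
    qed
    then show "x \<in> convex hull K"
      using u fin by (auto simp: convex_hull_finite)
  qed
  moreover have "convex hull K \<subseteq> P"
    using KP P by (intro hull_minimal) auto
  ultimately show ?thesis
    using indep card fin unfolding simplex by (intro exI [of _ K]) auto
qed

text \<open>A simplex has only \<open>d + 1\<close> vertices, so two non-adjacent ones could share a colour.\<close>
lemma simplex_imp_clique:
  fixes P :: "'a::euclidean_space set"
  assumes poly: "polytope P" and self: "P = uminus ` polar P" and dim: "aff_dim P = int DIM('a)"
    and "m simplex P"
  obtains K where "clique (polytope_graph P) (DIM('a) + 1) K"
proof -
  obtain K where K: "\<not> affine_dependent K" "int (card K) = m + 1" "P = convex hull K"
    using \<open>m simplex P\<close> by (auto simp: simplex_def)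
  have fin: "finite K"
    using K(1) by (rule aff_independent_finite)
  \<comment> \<open>Full dimension of \<open>P\<close> forces \<open>m\<close> to be the dimension
    of the space.\<close>
  have card: "card K = DIM('a) + 1"
    using aff_dim_affine_independent [OF K(1)] dim by (simp add: K(3) aff_dim_convex_hull)
  have ext: "v extreme_point_of P \<longleftrightarrow> v \<in> K" for v
    unfolding K(3) by (rule extreme_point_of_convex_hull_affine_independent [OF K(1)])
  have "v \<bullet> w = -1" if vw: "v \<in> K" "w \<in> K" "v \<noteq> w" for v w
  proof (rule ccontr)
    assume nonadj: "v \<bullet> w \<noteq> -1"
    obtain h where h: "bij_betw h (K - {w}) {0..<DIM('a)}"
      using ex_bij_betw_finite_nat [of "K - {w}"] fin card vw(2) by auto
    \<comment> \<open>\<open>h\<close> gives the other \<open>DIM('a)\<close> vertices distinct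
      colours, and \<open>w\<close> shares the colour of \<open>v\<close>.\<close>
    define c where "c = h(w := h v)"
    have "c ` K \<subseteq> {..<DIM('a)}"
      using h vw by (auto simp: c_def bij_betw_def)
    moreover have "c x \<noteq> c y" if "x \<in> K" "y \<in> K" "x \<bullet> y = -1" for x y
    proof
      assume "c x = c y"
      have "x \<noteq> y"
        using that(3) by (metis inner_ge_zero neg_0_le_iff_le not_one_le_zero)
      moreover have "inj_on h (K - {w})"
        using h by (simp add: bij_betw_def)
      ultimately have "x = w \<and> y = v \<or> x = v \<and> y = w"
        using \<open>c x = c y\<close> that vw by (auto simp: c_def inj_on_def split: if_splits)
      then show False
        using that(3) nonadj by (auto simp: inner_commute)
    qed
    ultimately have "colourable (polytope_graph P) DIM('a)"
      by (auto simp: colourable_def proper_colouring_def polytope_graph_def ext intro!: exI [of _ c])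
    then show False
      using not_colourable_self_polar [OF poly self] by blast
  qed
  then have "clique (polytope_graph P) (DIM('a) + 1) K"
    using fin card by (auto simp: clique_def polytope_graph_def ext)
  then show ?thesis
    by (rule that)
qed

lemma colourable_mono:
  assumes "colourable G k" "k \<le> l"
  shows "colourable G l"
  using assms by (force simp: colourable_def)

theorem theorem8p2:
  fixes P :: "(real ^ 'n) set"
  assumes "polytope P"
    and "aff_dim P = int CARD('n)"
    and "P = uminus ` polar P"
  shows "chromatic_number (polytope_graph P) \<ge> CARD('n) + 1
    \<and> ((\<exists>K. clique (polytope_graph P) (CARD('n) + 1) K) \<longleftrightarrow> (\<exists>m. m simplex P))"
proof (intro conjI iffI)
  have "\<not> chromatic_number (polytope_graph P) \<le> CARD('n)"
    using not_colourable_self_polar [OF assms(1,3)]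
      colourable_chromatic_number [OF pair_graph_polytope_graph [OF assms(1)]] colourable_mono
    by auto
  then show "chromatic_number (polytope_graph P) \<ge> CARD('n) + 1"
    by simp
next
  assume "\<exists>K. clique (polytope_graph P) (CARD('n) + 1) K"
  then show "\<exists>m. m simplex P"
    using clique_imp_simplex [OF assms(3) polytope_imp_convex [OF assms(1)]] by auto
next
  assume "\<exists>m. m simplex P"
  then show "\<exists>K. clique (polytope_graph P) (CARD('n) + 1) K"
    using simplex_imp_clique [OF assms(1,3)] assms(2) by (metis DIM_cart DIM_real mult_1_right)
qed

end
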